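(* Let $r\ge 0$ be an integer and let $n=\prod_{i=1}^{r}p_i^{e_i}$, where $p_1,\dots,p_r$ are distinct primes and $e_i\in\mathbb{Z}_{>0}$. Let $D_n$ be the set of positive divisors of $n$ ordered by divisibility. Then in the ruler game on $D_n$, the Grundy value of $y=p_1^{x_1}\cdots p_r^{x_r}\in D_n$ (with $0\le x_i\le e_i$) is \[ g(y)=h(x_1+1)\otimes h(x_2+1)\otimes\cdots\otimes h(x_r+1), \] where $h(x)=2^{v_2(x)}$ and $v_2(x)$ is the exponent of the largest power of $2$ dividing $x$.
   Context: Coin-turning games: let $X$ be a finite poset and $\mathcal{T}$ a family of nonempty subsets of $X$, each having a maximum element. In the game $\mathcal{G}(X,\mathcal{T})$ a position is a subset $H\subseteq X$ (the heads-up coins); a move from $H$ chooses $T\in\mathcal{T}$ with $\max T\in H$ and replaces $H$ by the symmetric difference $H\,\triangle\,T$; a player unable to move loses (normal play). The Grundy value $g(x)$ of $x\in X$ is the Sprague–Grundy value of the position $\{x\}$; equivalently $g(x)=\operatorname{mex}\{\bigoplus_{t\in T\setminus\{x\}}g(t) : T\in\mathcal{T},\ \max T=x\}$. The ruler on $X$ is the game $\mathcal{G}(X,\mathcal{I})$ where $\mathcal{I}$ is the set of all closed intervals $[a,b]=\{t\in X: a\le t\le b\}$ with $a\le b$ in $X$. Here $\oplus$ is nim-sum (bitwise XOR), $\operatorname{mex}(S)$ is the least nonnegative integer not in $S$, and $\otimes$ is Conway's nim-multiplication on nonnegative integers, defined recursively by $a\otimes b=\operatorname{mex}\{(a'\otimes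 b)\oplus(a\otimes b')\oplus(a'\otimes b') : a'<a,\ b'<b\}$. For $r=0$ (so $n=1$) the empty nim-product is interpreted as $1$. *)

theory Defs
  imports "HOL-Computational_Algebra.Primes"
begin

definition mex :: "nat set \<Rightarrow> nat" where
  "mex S = (LEAST k. k \<notin> S)"

abbreviation nim_sum :: "nat \<Rightarrow> nat \<Rightarrow> nat" (infixl "\<oplus>" 65) where
  "a \<oplus> b \<equiv> Bit_Operations.xor a b"

(* The pairs (a', b') range over a' < a and b' < b; the image form lets the
   function package see these bounds. *)
function nim_mult :: "nat \<Rightarrow> nat \<Rightarrow> nat" (infixl "\<otimes>" 70) where
  "a \<otimes> b = mex ((\<lambda>(a', b'). (a' \<otimes> b) \<oplus> (a \<otimes> b') \<oplus> (a' \<otimes> b')) ` ({..<a} \<times> {..<b}))"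
  by auto
termination
  by (relation "measure (\<lambda>(a, b). a + b)") auto

declare nim_mult.simps [simp del]

primrec nim_prod :: "(nat \<Rightarrow> nat) \<Rightarrow> nat \<Rightarrow> nat" where
  "nim_prod f 0 = 1"
| "nim_prod f (Suc r) = nim_prod f r \<otimes> f (Suc r)"

(* Sprague-Grundy value of a position under normal play, for a game given by the
   options of each position; meaningful when the option relation is well-founded. *)
definition grundy :: "('p \<Rightarrow> 'p set) \<Rightarrow> 'p \<Rightarrow> nat" where
  "grundy opts = wfrec {(q, p). q \<in> opts p} (\<lambda>g p. mex (g ` opts p))"

definition is_maximum :: "('a \<Rightarrow> 'a \<Rightarrow> bool) \<Rightarrow> 'a set \<Rightarrow> 'a \<Rightarrow> bool" where
  "is_maximum le T m \<longleftrightarrow> m \<in> T \<and> (\<forall>t\<in>T. le t m)"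

(* Posets are given by a carrier and an order relation that only matters on the carrier. *)
locale coin_turning_game =
  fixes X :: "'a set" and le :: "'a \<Rightarrow> 'a \<Rightarrow> bool" and \<T> :: "'a set set"
  assumes finite_carrier: "finite X"
    and refl: "reflp_on X le"
    and antisym: "antisymp_on X le"
    and trans: "transp_on X le"
    and turning_sets: "\<And>T. T \<in> \<T> \<Longrightarrow> T \<subseteq> X \<and> (\<exists>m. is_maximum le T m)"

definition coin_moves ::
    "'a set \<Rightarrow> ('a \<Rightarrow> 'a \<Rightarrow> bool) \<Rightarrow> 'a set set \<Rightarrow> 'a set \<Rightarrow> 'a set set" where
  "coin_moves X le \<T> H =
     {sym_diff H T | T m. H \<subseteq> X \<and> T \<in> \<T> \<and> is_maximum le T m \<and> m \<in> H}"

definition coin_grundy ::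
    "'a set \<Rightarrow> ('a \<Rightarrow> 'a \<Rightarrow> bool) \<Rightarrow> 'a set set \<Rightarrow> 'a \<Rightarrow> nat" where
  "coin_grundy X le \<T> x = grundy (coin_moves X le \<T>) {x}"

definition closed_intervals :: "'a set \<Rightarrow> ('a \<Rightarrow> 'a \<Rightarrow> bool) \<Rightarrow> 'a set set" where
  "closed_intervals X le = {{t \<in> X. le a t \<and> le t b} | a b. a \<in> X \<and> b \<in> X \<and> le a b}"

definition ruler_grundy :: "'a set \<Rightarrow> ('a \<Rightarrow> 'a \<Rightarrow> bool) \<Rightarrow> 'a \<Rightarrow> nat" where
  "ruler_grundy X le = coin_grundy X le (closed_intervals X le)"

definition divisors :: "nat \<Rightarrow> nat set" where
  "divisors n = {d. 0 < d \<and> d dvd n}"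

definition h :: "nat \<Rightarrow> nat" where
  "h x = 2 ^ multiplicity 2 x"

lemma one_nim_mult: "1 \<otimes> b = b"
proof (induction b rule: less_induct)
  case (less b)
  have zero: "0 \<otimes> c = 0" for c
    by (subst nim_mult.simps) (simp add: mex_def)
  have "(\<lambda>(a', b'). (a' \<otimes> b) \<oplus> (1 \<otimes> b') \<oplus> (a' \<otimes> b')) ` ({..<1} \<times> {..<b}) = {..<b}"
    using less.IH by (auto simp: zero image_iff)
  then have "1 \<otimes> b = mex {..<b}"
    by (subst nim_mult.simps) (simp only:)
  also have "\<dots> = b"
    unfolding mex_def by (rule Least_equality) auto
  finally show ?case .
qed

lemma grundy_rec:
  assumes "wf {(q, p). q \<in> opts p}"
  shows "grundy opts p = mex (grundy opts ` opts p)"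
proof -
  let ?R = "{(q, p). q \<in> opts p}"
  have "cut (grundy opts) ?R p ` opts p = grundy opts ` opts p"
    by (intro image_cong) (auto simp: cut_apply)
  then show ?thesis
    using wfrec [OF assms, of "\<lambda>g p. mex (g ` opts p)" p] by (simp add: grundy_def)
qed

context coin_turning_game
begin

lemma wf_coin_moves: "wf {(H', H). H' \<in> coin_moves X le \<T> H}"
proof -
  define rank where "rank x = card {y \<in> X. le y x \<and> y \<noteq> x}" for x
  define w where "w x = Suc (card X) ^ rank x" for x
  have rank_less: "rank t < rank m" if "t \<in> X" "m \<in> X" "le t m" "t \<noteq> m" for t m
  proof -
    have "{y \<in> X. le y t \<and> y \<noteq> t} \<subset> {y \<in> X. le y m \<and> y \<noteq> m}"
      using that antisym trans unfolding antisymp_on_def transp_on_def by blast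
    then show ?thesis
      unfolding rank_def using finite_carrier by (intro psubset_card_mono) auto
  qed
  have "sum w (sym_diff H T) < sum w H"
    if H: "H \<subseteq> X" and T: "T \<in> \<T>" and m: "is_maximum le T m" "m \<in> H" for H T m
  proof -
    have TX: "T \<subseteq> X" using turning_sets [OF T] by simp
    have mT: "m \<in> T" and le_m: "\<And>t. t \<in> T \<Longrightarrow> le t m"
      using m(1) by (auto simp: is_maximum_def)
    have fin: "finite H" "finite T"
      using H TX finite_carrier finite_subset by blast+
    have w_le: "Suc (card X) * w t \<le> w m" if "t \<in> T - H" for t
    proof -
      have "rank t < rank m"
        using that H TX m(2) mT le_m by (intro rank_less) auto
      then have "Suc (card X) ^ Suc (rank t) \<le> Suc (card X) ^ rank m"
        by (intro power_increasing) auto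
      then show ?thesis by (simp add: w_def)
    qed
    have "Suc (card X) * sum w (T - H) \<le> (\<Sum>t\<in>T - H. w m)"
      unfolding sum_distrib_left using w_le by (intro sum_mono)
    also have "\<dots> \<le> card X * w m"
      using TX finite_carrier by (simp add: card_mono subset_iff)
    also have "\<dots> < Suc (card X) * w m"
      by (simp add: w_def)
    finally have less: "sum w (T - H) < w m"
      by (simp only: mult_less_cancel1)
    have "sum w (sym_diff H T) = sum w (H - T) + sum w (T - H)"
      using fin by (intro sum.union_disjoint) auto
    also have "\<dots> < sum w (H - T) + w m"
      using less by simp
    also have "\<dots> = sum w (insert m (H - T))"
      using fin mT by simp
    also have "\<dots> \<le> sum w H"
      using fin m(2) by (intro sum_mono2) auto
    finally show ?thesis .
  qed
  then have "{(H', H). H' \<in> coin_moves X le \<T> H} \<subseteq> measure (sum w)"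
    by (auto simp: coin_moves_def)
  then show ?thesis
    by (rule wf_subset [OF wf_measure])
qed

lemmas grundy_coin_moves = grundy_rec [OF wf_coin_moves]

end

lemma ruler_coin_turning_game:
  assumes "finite X" "reflp_on X le" "antisymp_on X le" "transp_on X le"
  shows "coin_turning_game X le (closed_intervals X le)"
proof
  fix T assume "T \<in> closed_intervals X le"
  then obtain a b where ab: "a \<in> X" "b \<in> X" "le a b" "T = {t \<in> X. le a t \<and> le t b}"
    by (auto simp: closed_intervals_def)
  then have "is_maximum le T b"
    using assms(2) by (auto simp: is_maximum_def reflp_on_def)
  then show "T \<subseteq> X \<and> (\<exists>m. is_maximum le T m)"
    using ab by auto
qed (use assms in auto)

lemma divisors_ruler_game:
  assumes "n > 0"
  shows "coin_turning_game (divisors n) (dvd) (closed_intervals (divisors n) (dvd))"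
proof (rule ruler_coin_turning_game)
  show "finite (divisors n)"
    using assms by (auto simp: divisors_def)
  show "reflp_on (divisors n) (dvd)"
    by (auto simp: reflp_on_def)
  show "antisymp_on (divisors n) (dvd)"
    unfolding antisymp_on_def by (blast intro: dvd_antisym)
  show "transp_on (divisors n) (dvd)"
    unfolding transp_on_def by (blast intro: dvd_trans)
qed

end

theory Submission
  imports Defs
begin

text \<open>
  A function \<open>G\<close> on the coins that satisfies the mex recursion computes all Grundy values, because a
  position is then worth the nim-sum of \<open>G\<close> over its heads. For the candidate
  \<open>G y = h (x\<^sub>1 + 1) \<otimes> \<dots> \<otimes> h (x\<^sub>r + 1)\<close> the recursion is checked coordinatewise: intervals of
  divisors are products of intervals of exponents, so by distributivity the nim-sum of \<open>G\<close> over an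
  interval factors, and if \<open>a = mex A\<close> and \<open>b = mex B\<close> then \<open>a \<otimes> b\<close> is the mex of
  \<open>u \<otimes> b \<oplus> a \<otimes> v \<oplus> u \<otimes> v\<close> over \<open>u \<in> A\<close>, \<open>v \<in> B\<close> (the Tartan theorem). Associativity of \<open>\<otimes>\<close> plays
  no role. In one coordinate, the nim-sums of \<open>h\<close> over initial segments form the Gray code
  \<open>n \<oplus> \<lfloor>n / 2\<rfloor>\<close>.
\<close>

section \<open>Nim arithmetic\<close>

text \<open>As a relation, mex includes the existence of a missing number, which
  \<open>LEAST\<close> alone does not guarantee. Two nim expressions can then be equated by finding
  one set of which both are the mex.\<close>

definition is_mex :: "nat set \<Rightarrow> nat \<Rightarrow> bool" where
  "is_mex S k \<longleftrightarrow> k \<notin> S \<and> {..<k} \<subseteq> S"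

lemma is_mex_imp_mex_eq: "is_mex S k \<Longrightarrow> mex S = k"
  unfolding mex_def is_mex_def by (intro Least_equality) (auto simp: not_le[symmetric])

lemma is_mex_unique: "is_mex S k \<Longrightarrow> is_mex S l \<Longrightarrow> k = l"
  using is_mex_imp_mex_eq by blast

lemma is_mex_mex:
  assumes "finite S"
  shows "is_mex S (mex S)"
proof -
  obtain k where "k \<notin> S"
    using assms infinite_UNIV_nat ex_new_if_finite by blast
  then have "mex S \<notin> S"
    unfolding mex_def by (rule LeastI)
  then show ?thesis
    unfolding is_mex_def mex_def using not_less_Least by blast
qed

lemma xor_left_self [simp]: "a \<oplus> (a \<oplus> b) = (b::nat)"
  by (simp flip: xor.assoc)

lemmas xor_ac = xor.assoc xor.commute xor.left_commute

lemma xor_eq_iff: "a \<oplus> b = c \<longleftrightarrow> a = b \<oplus> (c::nat)"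
  by (metis xor.commute xor_left_self)

lemma xor_left_cancel: "a \<oplus> b = a \<oplus> c \<Longrightarrow> b = (c::nat)"
  by (metis xor_left_self)

lemma xor_right_cancel: "b \<oplus> a = c \<oplus> a \<Longrightarrow> b = (c::nat)"
  by (metis xor.commute xor_left_self)

lemma xor_div_2: "(a \<oplus> b) div 2 = (a div 2) \<oplus> (b div (2::nat))"
  using drop_bit_xor[of 1 a b] by (simp add: drop_bit_eq_div)

lemma even_xor_iff: "even (a \<oplus> (b::nat)) \<longleftrightarrow> (even a \<longleftrightarrow> even b)"
  using bit_xor_iff[of a b 0] by (auto simp: bit_0)

lemma less_if_div_2_eq: "a div 2 = b div 2 \<Longrightarrow> even a \<Longrightarrow> odd b \<Longrightarrow> a < (b::nat)"
  by presburger

text \<open>Induction by halving. If \<open>z\<close> and \<open>x \<oplus> y\<close> differ above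
  the last bit, the halves inherit the inequality. Otherwise exactly one of \<open>x\<close> and
  \<open>y\<close> is odd, and the claim holds there by clearing its last bit.\<close>

lemma less_xor_cases:
  fixes x y z :: nat
  assumes "z < x \<oplus> y"
  shows "z \<oplus> y < x \<or> x \<oplus> z < y"
  using assms
proof (induction "x + y" arbitrary: x y z rule: less_induct)
  case less
  have ne: "x + y \<noteq> 0"
    using less.prems by (cases "x + y = 0") auto
  show ?case
  proof (cases "z div 2 = (x \<oplus> y) div 2")
    case True
    moreover have "a < b \<Longrightarrow> a div 2 = b div 2 \<Longrightarrow> even a \<and> odd b" for a b :: nat
      by presburger
    ultimately have par: "even z" "odd (x \<oplus> y)"
      using less.prems by blast+
    have "(z \<oplus> y) div 2 = x div 2" "(x \<oplus> z) div 2 = y div 2"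
      using True by (simp_all add: xor_div_2 xor_ac)
    moreover have "even (z \<oplus> y) \<longleftrightarrow> even y" "even (x \<oplus> z) \<longleftrightarrow> even x" "even x \<noteq> even y"
      using par by (auto simp: even_xor_iff)
    ultimately show ?thesis
      using less_if_div_2_eq by metis
  next
    case False
    then have "z div 2 < (x \<oplus> y) div 2"
      using less.prems by linarith
    then have "z div 2 < (x div 2) \<oplus> (y div 2)"
      by (simp add: xor_div_2)
    moreover have "x div 2 + y div 2 < x + y"
      using ne by linarith
    ultimately have "(z div 2) \<oplus> (y div 2) < x div 2 \<or> (x div 2) \<oplus> (z div 2) < y div 2"
      using less.hyps by blast
    then have "(z \<oplus> y) div 2 < x div 2 \<or> (x \<oplus> z) div 2 < y div 2"
      by (simp add: xor_div_2)
    then show ?thesis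
      by linarith
  qed
qed

text \<open>The Sprague-Grundy rule for a sum of two games with option values \<open>U\<close> and
  \<open>V\<close>: cancellation excludes \<open>a \<oplus> b\<close>, and
  \<open>less_xor_cases\<close> finds an option for every smaller number.\<close>

lemma is_mex_xor:
  assumes "is_mex U a" "is_mex V b"
  shows "is_mex ((\<lambda>u. u \<oplus> b) ` U \<union> (\<lambda>v. a \<oplus> v) ` V) (a \<oplus> b)"
  unfolding is_mex_def
proof (intro conjI subsetI)
  show "a \<oplus> b \<notin> (\<lambda>u. u \<oplus> b) ` U \<union> (\<lambda>v. a \<oplus> v) ` V"
    using assms unfolding is_mex_def by (auto dest: xor_left_cancel xor_right_cancel)
next
  fix z assume "z \<in> {..<a \<oplus> b}"
  then have "z \<oplus> b < a \<or> a \<oplus> z < b"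
    by (intro less_xor_cases) auto
  then have "z \<oplus> b \<in> U \<or> a \<oplus> z \<in> V"
    using assms unfolding is_mex_def by auto
  moreover have "z = (z \<oplus> b) \<oplus> b" "z = a \<oplus> (a \<oplus> z)"
    by (simp_all add: xor_ac)
  ultimately show "z \<in> (\<lambda>u. u \<oplus> b) ` U \<union> (\<lambda>v. a \<oplus> v) ` V"
    by blast
qed

lemma is_mex_lessThan: "is_mex {..<a} a"
  by (auto simp: is_mex_def)

section \<open>Nim-multiplication: arbitrary option sets and distributivity\<close>

lemma is_mex_nim_mult_lessThan:
  "is_mex ((\<lambda>(u, v). u \<otimes> b \<oplus> a \<otimes> v \<oplus> u \<otimes> v) ` ({..<a} \<times> {..<b})) (a \<otimes> b)"
  by (subst (4) nim_mult.simps) (intro is_mex_mex finite_imageI finite_cartesian_product finite_lessThan)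

lemma nim_mult_rectangle_less:
  assumes "u < a" "v < b"
  shows "u \<otimes> b \<oplus> a \<otimes> v \<oplus> u \<otimes> v \<noteq> a \<otimes> b"
  using is_mex_nim_mult_lessThan[of b a] assms unfolding is_mex_def by force

text \<open>The condition is symmetric in the four corners of the rectangle, so only the order of the
  coordinates in each factor matters.\<close>

lemma nim_mult_rectangle:
  assumes "u \<noteq> a" "v \<noteq> b"
  shows "u \<otimes> b \<oplus> a \<otimes> v \<oplus> u \<otimes> v \<noteq> a \<otimes> b"
proof -
  consider "u < a" "v < b" | "u < a" "b < v" | "a < u" "v < b" | "a < u" "b < v"
    using assms by linarith
  then show ?thesis
    using nim_mult_rectangle_less[of u a v b] nim_mult_rectangle_less[of u a b v]
      nim_mult_rectangle_less[of a u v b] nim_mult_rectangle_less[of a u b v]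
    by cases (auto simp: xor_eq_iff xor_ac)
qed

text \<open>Enlarging \<open>{..<a} \<times> {..<b}\<close> to \<open>A \<times> B\<close> may add
  values but never \<open>a \<otimes> b\<close>, because \<open>u \<noteq> a\<close> and
  \<open>v \<noteq> b\<close> are all that \<open>nim_mult_rectangle\<close> asks for.\<close>

lemma is_mex_nim_mult:
  assumes "is_mex A a" "is_mex B b"
  shows "is_mex ((\<lambda>(u, v). u \<otimes> b \<oplus> a \<otimes> v \<oplus> u \<otimes> v) ` (A \<times> B)) (a \<otimes> b)"
  unfolding is_mex_def
proof
  have "u \<otimes> b \<oplus> a \<otimes> v \<oplus> u \<otimes> v \<noteq> a \<otimes> b" if "u \<in> A" "v \<in> B" for u v
    using assms that by (intro nim_mult_rectangle) (auto simp: is_mex_def)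
  then show "a \<otimes> b \<notin> (\<lambda>(u, v). u \<otimes> b \<oplus> a \<otimes> v \<oplus> u \<otimes> v) ` (A \<times> B)"
    by fastforce
  have "{..<a} \<times> {..<b} \<subseteq> A \<times> B"
    using assms by (auto simp: is_mex_def)
  then show "{..<a \<otimes> b} \<subseteq> (\<lambda>(u, v). u \<otimes> b \<oplus> a \<otimes> v \<oplus> u \<otimes> v) ` (A \<times> B)"
    using is_mex_nim_mult_lessThan[of b a] unfolding is_mex_def by blast
qed

text \<open>Both sides are the mex of one set. For this the options of \<open>a \<oplus> b\<close>
  are not all smaller numbers but those of a sum of games, \<open>u \<oplus> b\<close> and
  \<open>a \<oplus> v\<close>, as \<open>is_mex_nim_mult\<close> permits.\<close>

lemma nim_mult_distrib_right: "(a \<oplus> b) \<otimes> c = a \<otimes> c \<oplus> b \<otimes> c"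
proof (induction "a + b + c" arbitrary: a b c rule: less_induct)
  case less
  let ?E = "\<lambda>a c (u, v). u \<otimes> c \<oplus> a \<otimes> v \<oplus> u \<otimes> v"
  have "is_mex ((\<lambda>u. u \<oplus> b) ` {..<a} \<union> (\<lambda>v. a \<oplus> v) ` {..<b}) (a \<oplus> b)"
    by (intro is_mex_xor is_mex_lessThan)
  then have 1: "is_mex (?E (a \<oplus> b) c ` (((\<lambda>u. u \<oplus> b) ` {..<a} \<union> (\<lambda>v. a \<oplus> v) ` {..<b}) \<times> {..<c}))
      ((a \<oplus> b) \<otimes> c)" (is "is_mex ?L _")
    by (intro is_mex_nim_mult is_mex_lessThan)
  have 2: "is_mex ((\<lambda>z. z \<oplus> b \<otimes> c) ` ?E a c ` ({..<a} \<times> {..<c}) \<union>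
      (\<lambda>z. a \<otimes> c \<oplus> z) ` ?E b c ` ({..<b} \<times> {..<c})) (a \<otimes> c \<oplus> b \<otimes> c)" (is "is_mex ?R _")
    by (intro is_mex_xor is_mex_nim_mult_lessThan)
  \<comment> \<open>After expansion by the induction hypothesis the two copies of
    \<open>b \<otimes> v\<close> cancel.\<close>
  have "?E (a \<oplus> b) c (u \<oplus> b, v) = ?E a c (u, v) \<oplus> b \<otimes> c" if "u < a" "v < c" for u v
    using that less[of u b c] less[of a b v] less[of u b v] by (simp add: xor_ac)
  then have L1: "?E (a \<oplus> b) c ` ((\<lambda>u. u \<oplus> b) ` {..<a} \<times> {..<c}) =
      (\<lambda>z. z \<oplus> b \<otimes> c) ` ?E a c ` ({..<a} \<times> {..<c})"
    by (force simp: image_iff)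
  have "?E (a \<oplus> b) c (a \<oplus> u, v) = a \<otimes> c \<oplus> ?E b c (u, v)" if "u < b" "v < c" for u v
    using that less[of a u c] less[of a b v] less[of a u v] by (simp add: xor_ac)
  then have L2: "?E (a \<oplus> b) c ` ((\<lambda>u. a \<oplus> u) ` {..<b} \<times> {..<c}) =
      (\<lambda>z. a \<otimes> c \<oplus> z) ` ?E b c ` ({..<b} \<times> {..<c})"
    by (force simp: image_iff)
  have "?L = ?R"
    by (simp only: Sigma_Un_distrib1 image_Un L1 L2)
  with 1 have "is_mex ?R ((a \<oplus> b) \<otimes> c)"
    by (simp only:)
  then show ?case
    using 2 by (rule is_mex_unique)
qed

lemma nim_mult_commute: "a \<otimes> b = b \<otimes> a"
proof (induction "a + b" arbitrary: a b rule: less_induct)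
  case less
  let ?E = "\<lambda>a b (u, v). u \<otimes> b \<oplus> a \<otimes> v \<oplus> u \<otimes> v"
  have "?E a b (u, v) = ?E b a (v, u)" if "u < a" "v < b" for u v
    using that less[of u b] less[of a v] less[of u v] by (simp add: xor_ac)
  then have "?E a b ` ({..<a} \<times> {..<b}) = ?E b a ` ({..<b} \<times> {..<a})"
    by (force simp: image_iff)
  then have "is_mex (?E b a ` ({..<b} \<times> {..<a})) (a \<otimes> b)"
    using is_mex_nim_mult_lessThan[of b a] by (simp only:)
  then show ?case
    using is_mex_nim_mult_lessThan by (rule is_mex_unique)
qed

lemma nim_mult_distrib_left: "c \<otimes> (a \<oplus> b) = c \<otimes> a \<oplus> c \<otimes> b"
  using nim_mult_distrib_right[of a b c] by (simp add: nim_mult_commute)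

lemma zero_nim_mult [simp]: "0 \<otimes> a = 0" "a \<otimes> 0 = 0"
  using nim_mult_distrib_right[of 0 0 a] nim_mult_distrib_left[of a 0 0] by simp_all

section \<open>Finite nim-sums\<close>

global_interpretation nim_Sum: comm_monoid_set "Bit_Operations.xor" "0 :: nat"
  defines nim_Sum = nim_Sum.F
  by unfold_locales (auto simp: xor_ac)

lemma nim_Sum_nim_mult_distrib_right: "nim_Sum f A \<otimes> c = nim_Sum (\<lambda>a. f a \<otimes> c) A"
  by (induction A rule: infinite_finite_induct) (simp_all add: nim_mult_distrib_right)

lemma nim_Sum_nim_mult_distrib_left: "c \<otimes> nim_Sum f A = nim_Sum (\<lambda>a. c \<otimes> f a) A"
  by (induction A rule: infinite_finite_induct) (simp_all add: nim_mult_distrib_left)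

lemma nim_Sum_product:
  "nim_Sum f A \<otimes> nim_Sum g B = nim_Sum (\<lambda>(a, b). f a \<otimes> g b) (A \<times> B)"
proof -
  have "nim_Sum f A \<otimes> nim_Sum g B = nim_Sum (\<lambda>a. nim_Sum (\<lambda>b. f a \<otimes> g b) B) A"
    by (subst nim_Sum_nim_mult_distrib_right) (simp only: nim_Sum_nim_mult_distrib_left)
  then show ?thesis
    by (simp only: nim_Sum.cartesian_product)
qed

text \<open>Common elements occur twice and cancel; hence turning \<open>T\<close> changes the value
  of a position by \<open>nim_Sum f T\<close>.\<close>

lemma nim_Sum_sym_diff:
  assumes "finite A" "finite B"
  shows "nim_Sum f (sym_diff A B) = nim_Sum f A \<oplus> nim_Sum f B"
proof -
  have "nim_Sum f (sym_diff A B) = nim_Sum f (A - B) \<oplus> nim_Sum f (B - A)"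
    using assms by (intro nim_Sum.union_disjoint) auto
  moreover have "nim_Sum f A = nim_Sum f (A - B) \<oplus> nim_Sum f (A \<inter> B)"
    using assms nim_Sum.Int_Diff[of A f B] by (simp add: xor_ac)
  moreover have "nim_Sum f B = nim_Sum f (B - A) \<oplus> nim_Sum f (A \<inter> B)"
    using assms nim_Sum.Int_Diff[of B f A] by (simp add: xor_ac Int_commute)
  ultimately show ?thesis
    by (simp add: xor_ac)
qed

text \<open>The winning move in Nim: some summand can be lowered so that the total becomes
  \<open>z\<close>. It follows from \<open>less_xor_cases\<close> by adding one summand at a
  time.\<close>

lemma less_nim_Sum_cases:
  assumes "finite A" "z < nim_Sum f A"
  shows "\<exists>a\<in>A. z \<oplus> nim_Sum f A \<oplus> f a < f a"
  using assms
proof (induction A arbitrary: z rule: finite_induct)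
  case (insert b A)
  then have "z < f b \<oplus> nim_Sum f A"
    by simp
  then consider "z \<oplus> nim_Sum f A < f b" | "f b \<oplus> z < nim_Sum f A"
    using less_xor_cases by blast
  then show ?case
  proof cases
    case 1
    then show ?thesis
      using insert.hyps by (intro bexI[of _ b]) (simp_all add: xor_ac)
  next
    case 2
    from insert.IH[OF this] show ?thesis
      using insert.hyps by (auto simp: xor_ac)
  qed
qed simp

section \<open>Grundy values of coin-turning games\<close>

context coin_turning_game
begin

text \<open>Hypothesis \<open>G\<close> is the mex recursion for single coins: since
  \<open>m \<in> T\<close>, the extra \<open>G m\<close> cancels the contribution of
  \<open>m\<close> to the nim-sum over \<open>T\<close>.\<close>

lemma grundy_eq_nim_Sum:
  assumes G: "\<And>m. m \<in> X \<Longrightarrow>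
      is_mex ((\<lambda>T. nim_Sum G T \<oplus> G m) ` {T \<in> \<T>. is_maximum le T m}) (G m)"
    and H: "H \<subseteq> X"
  shows "grundy (coin_moves X le \<T>) H = nim_Sum G H"
  using wf_coin_moves H
proof (induction H rule: wf_induct_rule)
  case (less H)
  let ?g = "grundy (coin_moves X le \<T>)"
  have fin: "finite T" if "T \<subseteq> X" for T
    using finite_carrier that finite_subset by blast
  have TX: "T \<subseteq> X" if "T \<in> \<T>" for T
    using turning_sets[OF that] by simp
  have move: "sym_diff H T \<in> coin_moves X le \<T> H"
    if "T \<in> \<T>" "is_maximum le T m" "m \<in> H" for T m
    using that less.prems unfolding coin_moves_def by blast
  have g: "?g (sym_diff H T) = nim_Sum G H \<oplus> nim_Sum G T"
    if "T \<in> \<T>" "is_maximum le T m" "m \<in> H" for T m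
  proof -
    have "?g (sym_diff H T) = nim_Sum G (sym_diff H T)"
      using move[OF that] TX[OF that(1)] less.prems by (intro less.IH) auto
    then show ?thesis
      using fin less.prems TX[OF that(1)] by (simp add: nim_Sum_sym_diff)
  qed
  have "is_mex (?g ` coin_moves X le \<T> H) (nim_Sum G H)"
    unfolding is_mex_def
  proof (intro conjI subsetI notI)
    assume "nim_Sum G H \<in> ?g ` coin_moves X le \<T> H"
    then obtain T m where T: "T \<in> \<T>" "is_maximum le T m" "m \<in> H"
      and "nim_Sum G H = ?g (sym_diff H T)"
      unfolding coin_moves_def by blast
    \<comment> \<open>A move preserving the value would make \<open>G m\<close> one of the option
      values at \<open>m\<close>.\<close>
    then have "nim_Sum G T = 0"
      using g[OF T] by (metis xor_left_self xor_self_eq)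
    then have "G m = nim_Sum G T \<oplus> G m"
      by simp
    then show False
      using G[of m] T less.prems unfolding is_mex_def by blast
  next
    fix z assume "z \<in> {..<nim_Sum G H}"
    \<comment> \<open>The coin \<open>m\<close> must be replaced by coins of total value
      \<open>z \<oplus> nim_Sum G H \<oplus> G m\<close>. This lies below \<open>G m\<close>, so the
      recursion at \<open>m\<close> supplies a suitable \<open>T\<close>.\<close>
    then obtain m where m: "m \<in> H" "z \<oplus> nim_Sum G H \<oplus> G m < G m"
      using less_nim_Sum_cases[OF fin[OF less.prems], of z G] by auto
    then have "z \<oplus> nim_Sum G H \<oplus> G m \<in> (\<lambda>T. nim_Sum G T \<oplus> G m) ` {T \<in> \<T>. is_maximum le T m}"
      using G[of m] less.prems unfolding is_mex_def by blast
    then obtain T where T: "T \<in> \<T>" "is_maximum le T m"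
      and "z \<oplus> nim_Sum G H \<oplus> G m = nim_Sum G T \<oplus> G m"
      by auto
    then have "z = nim_Sum G H \<oplus> nim_Sum G T"
      by (metis xor.commute xor_left_self)
    then show "z \<in> ?g ` coin_moves X le \<T> H"
      using g[OF T m(1)] move[OF T m(1)] by (metis imageI)
  qed
  then show ?case
    using grundy_coin_moves[of H] is_mex_imp_mex_eq by metis
qed

end

section \<open>The ruler on a chain and on a box\<close>

definition gray :: "nat \<Rightarrow> nat" where
  "gray n = n \<oplus> n div 2"

lemma gray_div_2: "gray n div 2 = gray (n div 2)"
  by (simp add: gray_def xor_div_2)

lemma even_gray_iff: "even (gray n) \<longleftrightarrow> (even n \<longleftrightarrow> even (n div 2))"
  by (simp add: gray_def even_xor_iff)

lemma gray_div_power_2: "gray n div 2 ^ k = gray (n div 2 ^ k)"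
  by (induction k arbitrary: n) (simp_all add: div_mult2_eq gray_div_2)

text \<open>Halving commutes with \<open>gray\<close>, so by induction \<open>m\<close> and
  \<open>n\<close> have equal halves, and cancelling these leaves \<open>m = n\<close>.\<close>

lemma gray_inject: "gray m = gray n \<Longrightarrow> m = n"
proof (induction "m + n" arbitrary: m n rule: less_induct)
  case less
  show ?case
  proof (cases "m + n = 0")
    case False
    have "gray (m div 2) = gray (n div 2)"
      using less.prems by (metis gray_div_2)
    moreover have "m div 2 + n div 2 < m + n"
      using False by linarith
    ultimately have "m div 2 = n div 2"
      using less.hyps by blast
    then show ?thesis
      using less.prems xor_right_cancel[of m "n div 2" n] by (simp add: gray_def)
  qed simp
qed

lemma h_odd: "odd n \<Longrightarrow> h n = 1"
  by (simp add: h_def not_dvd_imp_multiplicity_0)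

lemma h_double: "n > 0 \<Longrightarrow> h (2 * n) = 2 * h n"
  by (simp add: h_def multiplicity_times_same)

text \<open>For even \<open>n\<close> the numbers \<open>n\<close> and \<open>Suc n\<close> have the
  same half, so the codes differ in the last bit only. For odd \<open>n\<close> the last bits agree
  and the difference is twice that of the halves, as in \<open>h_double\<close>.\<close>

lemma gray_Suc: "gray (Suc n) = gray n \<oplus> h (Suc n)"
proof -
  have "gray n \<oplus> gray (Suc n) = h (Suc n)"
  proof (induction n rule: less_induct)
    case (less n)
    have d: "(gray n \<oplus> gray (Suc n)) div 2 = gray (n div 2) \<oplus> gray (Suc n div 2)"
      by (simp add: xor_div_2 gray_div_2)
    show ?case
    proof (cases "even n")
      case True
      then have "Suc n div 2 = n div 2"
        by presburger
      then have "(gray n \<oplus> gray (Suc n)) div 2 = 0" "odd (gray n \<oplus> gray (Suc n))"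
        using d True by (simp_all add: even_xor_iff even_gray_iff)
      then have "gray n \<oplus> gray (Suc n) = 1"
        by (metis div_mult_mod_eq odd_iff_mod_2_eq_one mult_zero_left add_0)
      then show ?thesis
        using True by (simp add: h_odd)
    next
      case False
      then obtain m where m: "n = 2 * m + 1"
        by (elim oddE)
      then have "(gray n \<oplus> gray (Suc n)) div 2 = h (Suc m)"
        using d less.IH[of m] by simp
      moreover have "even (gray n \<oplus> gray (Suc n))"
        using m by (simp add: even_xor_iff even_gray_iff)
      ultimately have "gray n \<oplus> gray (Suc n) = 2 * h (Suc m)"
        by (metis dvd_mult_div_cancel)
      then show ?thesis
        using h_double[of "Suc m"] m by simp
    qed
  qed
  then show ?thesis
    by (metis xor_left_self)
qed

text \<open>By \<open>gray_Suc\<close> the sum telescopes; the shift in \<open>h (j + 1)\<close>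
  puts the upper end at \<open>Suc x\<close>.\<close>

lemma nim_Sum_h:
  assumes "a \<le> x"
  shows "nim_Sum (\<lambda>j. h (j + 1)) {a..x} = gray (Suc x) \<oplus> gray a"
  using assms
proof (induction x rule: dec_induct)
  case base
  then show ?case
    by (simp add: gray_Suc xor_ac)
next
  case (step x)
  then have "{a..Suc x} = insert (Suc x) {a..x}"
    by auto
  then show ?case
    using step gray_Suc[of "Suc x"] by (simp add: xor_ac)
qed

text \<open>The run sums ending just below \<open>x\<close> are \<open>gray x \<oplus> gray a\<close>. On the block of the \<open>h (x + 1)\<close>
  values of \<open>a\<close> up to \<open>x\<close> they are distinct and agree in the high bits, so they exhaust the
  numbers below \<open>h (x + 1)\<close>.\<close>

lemma is_mex_chain_ruler:
  "is_mex ((\<lambda>a. nim_Sum (\<lambda>j. h (j + 1)) {a..x} \<oplus> h (x + 1)) ` {..x}) (h (x + 1))"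
proof -
  define k where "k = multiplicity 2 (Suc x)"
  have hk: "h (x + 1) = 2 ^ k"
    by (simp add: h_def k_def)
  have "(2::nat) ^ k dvd Suc x"
    unfolding k_def by (rule multiplicity_dvd)
  then obtain q where q: "Suc x = 2 ^ k * q"
    by (elim dvdE)
  then obtain q' where q': "q = Suc q'"
    by (cases q) auto
  have sum: "nim_Sum (\<lambda>j. h (j + 1)) {a..x} \<oplus> h (x + 1) = gray x \<oplus> gray a" if "a \<le> x" for a
    using that gray_Suc[of x] by (simp only: nim_Sum_h Suc_eq_plus1) (simp add: xor_ac)
  then have image: "(\<lambda>a. nim_Sum (\<lambda>j. h (j + 1)) {a..x} \<oplus> h (x + 1)) ` {..x}
      = (\<lambda>a. gray x \<oplus> gray a) ` {..x}"
    by (intro image_cong) auto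
  \<comment> \<open>The block ends at \<open>x\<close>, because
    \<open>Suc x = 2 ^ k * Suc q'\<close>. All its elements have quotient \<open>q'\<close> by
    \<open>2 ^ k\<close>, so their codes agree from bit \<open>k\<close> upwards.\<close>
  let ?B = "{2 ^ k * q'..<2 ^ k * q' + 2 ^ k}"
  have B: "?B \<subseteq> {..x}"
    using q q' by auto
  have div: "a div 2 ^ k = q'" if "a \<in> ?B" for a
    using that by (intro div_nat_eqI) (auto simp: algebra_simps)
  have "(2::nat) ^ k > 0"
    by simp
  then have "x \<in> ?B"
    using q[unfolded q' mult_Suc_right] unfolding atLeastLessThan_iff by linarith
  then have "(gray x \<oplus> gray a) div 2 ^ k = 0" if "a \<in> ?B" for a
    using div that gray_div_power_2 drop_bit_xor[of k "gray x" "gray a"]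
    by (simp add: drop_bit_eq_div)
  then have sub: "(\<lambda>a. gray x \<oplus> gray a) ` ?B \<subseteq> {..<2 ^ k}"
    by (auto simp: div_eq_0_iff)
  have "inj_on (\<lambda>a. gray x \<oplus> gray a) ?B"
    by (rule inj_onI, rule gray_inject, rule xor_left_cancel)
  then have "(\<lambda>a. gray x \<oplus> gray a) ` ?B = {..<2 ^ k}"
    using sub by (intro card_subset_eq) (simp_all add: card_image)
  then have "{..<2 ^ k} \<subseteq> (\<lambda>a. gray x \<oplus> gray a) ` {..x}"
    using B by blast
  \<comment> \<open>The value \<open>2 ^ k\<close> would require the code of \<open>Suc x\<close>,
    which no \<open>a \<le> x\<close> has.\<close>
  moreover have "2 ^ k \<noteq> gray x \<oplus> gray a" if "a \<in> {..x}" for a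
  proof
    assume "2 ^ k = gray x \<oplus> gray a"
    then have "gray a = gray (Suc x)"
      using gray_Suc[of x] hk by (metis Suc_eq_plus1 xor_left_self)
    then show False
      using gray_inject that by fastforce
  qed
  ultimately have "is_mex ((\<lambda>a. gray x \<oplus> gray a) ` {..x}) (2 ^ k)"
    unfolding is_mex_def by blast
  then show ?thesis
    unfolding image unfolding hk .
qed

section \<open>From one coordinate to several\<close>

lemma nim_prod_cong: "(\<And>i. i \<in> {1..r} \<Longrightarrow> f i = g i) \<Longrightarrow> nim_prod f r = nim_prod g r"
  by (induction r) auto

text \<open>Induction on the dimension: the option values in \<open>Suc r\<close> coordinates are
  the Tartan combinations of those in the first \<open>r\<close> coordinates with those of the last
  chain, so \<open>is_mex_nim_mult\<close> applies.\<close>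

lemma is_mex_box_ruler:
  "is_mex ((\<lambda>a. nim_prod (\<lambda>i. nim_Sum (\<lambda>j. h (j + 1)) {a i..x i}) r \<oplus> nim_prod (\<lambda>i. h (x i + 1)) r)
     ` {a. \<forall>i\<in>{1..r}. a i \<le> x i}) (nim_prod (\<lambda>i. h (x i + 1)) r)"
proof (induction r)
  \<comment> \<open>The only option value is \<open>1 \<oplus> 1 = 0\<close>, and its mex is the
    empty product \<open>1\<close>.\<close>
  case 0
  then show ?case
    by (auto simp: is_mex_def)
next
  case (Suc r)
  let ?s = "\<lambda>i b. nim_Sum (\<lambda>j. h (j + 1)) {b..x i}"
  let ?S = "\<lambda>r a. nim_prod (\<lambda>i. ?s i (a i)) r"
  let ?F = "nim_prod (\<lambda>i. h (x i + 1))"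
  let ?f = "h (x (Suc r) + 1)"
  let ?D = "\<lambda>r. {a. \<forall>i\<in>{1..r}. a i \<le> x i}"
  let ?A = "(\<lambda>a. ?S r a \<oplus> ?F r) ` ?D r"
  let ?B = "(\<lambda>b. ?s (Suc r) b \<oplus> ?f) ` {..x (Suc r)}"
  let ?E = "\<lambda>(u, v). u \<otimes> ?f \<oplus> ?F r \<otimes> v \<oplus> u \<otimes> v"
  \<comment> \<open>By distributivity \<open>?E (u, v)\<close> is \<open>(u \<oplus> ?F r) \<otimes>
    (v \<oplus> ?f) \<oplus> ?F r \<otimes> ?f\<close>, so adding back the top coins turns it into a
    product of full interval sums.\<close>
  have E: "?E (S \<oplus> ?F r, s \<oplus> ?f) = S \<otimes> s \<oplus> ?F r \<otimes> ?f" for S s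
    by (simp add: nim_mult_distrib_left nim_mult_distrib_right xor_ac)
  have "(\<lambda>a. ?S (Suc r) a \<oplus> ?F (Suc r)) ` ?D (Suc r) = ?E ` (?A \<times> ?B)"
  proof (intro equalityI subsetI)
    fix z assume "z \<in> (\<lambda>a. ?S (Suc r) a \<oplus> ?F (Suc r)) ` ?D (Suc r)"
    then obtain a where a: "a \<in> ?D (Suc r)" "z = ?S (Suc r) a \<oplus> ?F (Suc r)"
      by blast
    then have "z = ?E (?S r a \<oplus> ?F r, ?s (Suc r) (a (Suc r)) \<oplus> ?f)"
      by (simp only: E nim_prod.simps)
    moreover have "a \<in> ?D r" "a (Suc r) \<in> {..x (Suc r)}"
      using a by auto
    ultimately show "z \<in> ?E ` (?A \<times> ?B)"
      by blast
  next
    fix z assume "z \<in> ?E ` (?A \<times> ?B)"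
    then obtain a b where ab: "a \<in> ?D r" "b \<in> {..x (Suc r)}"
      and "z = ?E (?S r a \<oplus> ?F r, ?s (Suc r) b \<oplus> ?f)"
      by blast
    then have z: "z = ?S r a \<otimes> ?s (Suc r) b \<oplus> ?F r \<otimes> ?f"
      by (simp only: E)
    \<comment> \<open>Membership in \<open>?D r\<close> leaves coordinate \<open>Suc r\<close> free,
      so it can be set to \<open>b\<close>.\<close>
    let ?a = "a(Suc r := b)"
    have "?S r ?a = ?S r a"
      by (intro nim_prod_cong) auto
    then have "z = ?S (Suc r) ?a \<oplus> ?F (Suc r)"
      using z by simp
    moreover have "?a \<in> ?D (Suc r)"
      using ab by auto
    ultimately show "z \<in> (\<lambda>a. ?S (Suc r) a \<oplus> ?F (Suc r)) ` ?D (Suc r)"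
      by blast
  qed
  then show ?case
    using is_mex_nim_mult[OF Suc.IH is_mex_chain_ruler[of "x (Suc r)"]] by simp
qed

section \<open>The ruler on divisors\<close>

text \<open>A divisor of \<open>m * q ^ k\<close> splits into a divisor of \<open>m\<close> and a
  power of \<open>q\<close>. These are coprime, so the lower bound \<open>a * q ^ b\<close> can be
  tested on each factor separately.\<close>

lemma dvd_interval_mult_prime_power:
  fixes a m q :: nat
  assumes q: "prime q" "\<not> q dvd m" and "a dvd m"
  shows "{t. a * q ^ b dvd t \<and> t dvd m * q ^ k} =
    (\<lambda>(d, j). d * q ^ j) ` ({d. a dvd d \<and> d dvd m} \<times> {b..k})"
proof (intro equalityI subsetI)
  fix t assume "t \<in> {t. a * q ^ b dvd t \<and> t dvd m * q ^ k}"
  then have t: "a * q ^ b dvd t" "t dvd m * q ^ k"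
    by blast+
  then obtain d e where de: "t = d * e" "d dvd m" "e dvd q ^ k"
    using division_decomp[OF t(2)] by blast
  then obtain j where j: "j \<le> k" "e = q ^ j"
    using divides_primepow_nat[OF q(1)] by blast
  have "\<not> q dvd d" "\<not> q dvd a"
    using dvd_trans[of q d m] dvd_trans[of q a m] de(2) q(2) \<open>a dvd m\<close> by argo+
  then have cop: "coprime (q ^ i) d" "coprime a (q ^ i)" for i
    using prime_imp_coprime[OF q(1), of d] prime_imp_coprime[OF q(1), of a]
    by (auto simp: coprime_commute)
  have "a dvd d * q ^ j" "q ^ b dvd d * q ^ j"
    using dvd_mult_left[OF t(1)] dvd_mult_right[OF t(1)] de(1) j(2) by simp_all
  then have "a dvd d" "q ^ b dvd q ^ j"
    using cop by (simp_all add: coprime_dvd_mult_left_iff coprime_dvd_mult_right_iff)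
  then have "a dvd d" "b \<le> j"
    using q(1) by (simp_all add: dvd_power_iff_le prime_ge_2_nat)
  then show "t \<in> (\<lambda>(d, j). d * q ^ j) ` ({d. a dvd d \<and> d dvd m} \<times> {b..k})"
    using de j by auto
next
  fix t assume "t \<in> (\<lambda>(d, j). d * q ^ j) ` ({d. a dvd d \<and> d dvd m} \<times> {b..k})"
  then show "t \<in> {t. a * q ^ b dvd t \<and> t dvd m * q ^ k}"
    by (auto intro!: mult_dvd_mono le_imp_power_dvd)
qed

text \<open>Since \<open>q\<close> does not divide \<open>d\<close>, the exponent \<open>j\<close>
  is recovered as the multiplicity of \<open>q\<close>.\<close>

lemma inj_on_mult_prime_power:
  fixes m q :: nat
  assumes q: "prime q" "\<not> q dvd m"
  shows "inj_on (\<lambda>(d, j). d * q ^ j) ({d. d dvd m} \<times> UNIV)"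
proof (rule inj_onI, clarify)
  fix d j d' j'
  assume dvd: "d dvd m" "d' dvd m" and eq: "d * q ^ j = d' * q ^ j'"
  have mult: "multiplicity q (c * q ^ i) = i" if "c dvd m" for c i
  proof -
    have "\<not> q dvd c"
      using that q(2) dvd_trans[of q c m] by argo
    then show ?thesis
      using q(1) by (intro multiplicity_eqI) (auto simp: prime_gt_0_nat)
  qed
  have "j = j'"
    using mult[OF dvd(1), of j] mult[OF dvd(2), of j'] eq by simp
  then show "d = d' \<and> j = j'"
    using eq q(1) by auto
qed

section \<open>Products of powers of distinct primes\<close>

context
  fixes p :: "nat \<Rightarrow> nat" and R :: nat
  assumes primes: "\<forall>i\<in>{1..R}. prime (p i)" and inj: "inj_on p {1..R}"
begin

lemma prime_not_dvd_prod:
  assumes "Suc r \<le> R"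
  shows "\<not> p (Suc r) dvd (\<Prod>i=1..r. p i ^ x i)"
proof
  assume "p (Suc r) dvd (\<Prod>i=1..r. p i ^ x i)"
  then obtain i where i: "i \<in> {1..r}" "p (Suc r) dvd p i ^ x i"
    using primes assms by (auto simp: prime_dvd_prod_iff)
  then have "p (Suc r) = p i"
    using primes assms by (metis Suc_leD Suc_le_mono atLeastAtMost_iff le0 One_nat_def order_trans
        prime_dvd_power primes_dvd_imp_eq)
  then show False
    using inj_onD[OF inj, of "Suc r" i] i assms by auto
qed

lemma dvd_prod_prime_powersE:
  assumes "r \<le> R" "d dvd (\<Prod>i=1..r. p i ^ x i)"
  obtains a where "\<forall>i\<in>{1..r}. a i \<le> x i" "d = (\<Prod>i=1..r. p i ^ a i)"
proof -
  have "\<exists>a. (\<forall>i\<in>{1..r}. a i \<le> x i) \<and> d = (\<Prod>i=1..r. p i ^ a i)"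
    using assms
  proof (induction r arbitrary: d)
    case (Suc r)
    let ?q = "p (Suc r)"
    have "prime ?q"
      using primes Suc.prems by auto
    \<comment> \<open>The trivial lower bound \<open>1 * ?q ^ 0\<close> makes the interval the set
      of all divisors.\<close>
    then have "{t. 1 * ?q ^ 0 dvd t \<and> t dvd (\<Prod>i=1..r. p i ^ x i) * ?q ^ x (Suc r)} =
        (\<lambda>(d, j). d * ?q ^ j) ` ({d. 1 dvd d \<and> d dvd (\<Prod>i=1..r. p i ^ x i)} \<times> {0..x (Suc r)})"
      by (rule dvd_interval_mult_prime_power[OF _ prime_not_dvd_prod[OF Suc.prems(1)] one_dvd])
    moreover have "d \<in> {t. 1 * ?q ^ 0 dvd t \<and> t dvd (\<Prod>i=1..r. p i ^ x i) * ?q ^ x (Suc r)}"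
      using Suc.prems by simp
    ultimately have "d \<in> (\<lambda>(d, j). d * ?q ^ j) `
        ({d. 1 dvd d \<and> d dvd (\<Prod>i=1..r. p i ^ x i)} \<times> {0..x (Suc r)})"
      by (simp only:)
    then obtain c j where c: "c dvd (\<Prod>i=1..r. p i ^ x i)" "j \<le> x (Suc r)" "d = c * ?q ^ j"
      by auto
    then obtain a where a: "\<forall>i\<in>{1..r}. a i \<le> x i" "c = (\<Prod>i=1..r. p i ^ a i)"
      using Suc.IH[of c] Suc.prems by auto
    have "(\<Prod>i=1..Suc r. p i ^ (a(Suc r := j)) i) = d"
      using a(2) c(3) by simp
    moreover have "\<forall>i\<in>{1..Suc r}. (a(Suc r := j)) i \<le> x i"
      using a(1) c(2) by auto
    ultimately show ?case
      by metis
  qed simp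
  then show ?thesis
    using that by blast
qed

lemma multiplicity_prod_prime_powers_index:
  assumes "i \<in> {1..R}"
  shows "multiplicity (p i) (\<Prod>i=1..R. p i ^ x i) = x i"
proof -
  \<comment> \<open>The product is reindexed by the primes themselves, with
    \<open>the_inv_into\<close> recovering the index of each prime.\<close>
  have "(\<Prod>i=1..R. p i ^ x i) = (\<Prod>q\<in>p ` {1..R}. q ^ x (the_inv_into {1..R} p q))"
    using inj by (simp add: prod.reindex the_inv_into_f_f)
  moreover have "multiplicity (p i) (\<Prod>q\<in>p ` {1..R}. q ^ x (the_inv_into {1..R} p q)) =
      (if p i \<in> p ` {1..R} then x (the_inv_into {1..R} p (p i)) else 0)"
    using primes assms by (intro multiplicity_prod_prime_powers) auto
  ultimately show ?thesis
    using inj assms by (simp add: the_inv_into_f_f)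
qed

text \<open>An interval of divisors is a box of exponent vectors, and the candidate Grundy values are
  products over the coordinates, so distributivity factors the nim-sum.\<close>

lemma nim_Sum_dvd_interval:
  assumes "r \<le> R" "\<forall>i\<in>{1..r}. a i \<le> x i"
  shows "nim_Sum (\<lambda>t. nim_prod (\<lambda>i. h (multiplicity (p i) t + 1)) r)
      {t. (\<Prod>i=1..r. p i ^ a i) dvd t \<and> t dvd (\<Prod>i=1..r. p i ^ x i)} =
    nim_prod (\<lambda>i. nim_Sum (\<lambda>j. h (j + 1)) {a i..x i}) r"
  using assms
proof (induction r)
  case 0
  have "{t. Suc 0 dvd t \<and> t dvd Suc 0} = {1}"
    by auto
  then show ?case
    by simp
next
  case (Suc r)
  let ?q = "p (Suc r)"
  let ?A = "\<Prod>i=1..r. p i ^ a i" and ?Y = "\<Prod>i=1..r. p i ^ x i"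
  let ?G = "\<lambda>r t. nim_prod (\<lambda>i. h (multiplicity (p i) t + 1)) r"
  let ?I = "{d. ?A dvd d \<and> d dvd ?Y}" and ?J = "{a (Suc r)..x (Suc r)}"
  have q: "prime ?q" "\<not> ?q dvd ?Y"
    using primes Suc.prems prime_not_dvd_prod[of r x] by auto
  have "?A dvd ?Y"
    using Suc.prems by (intro prod_dvd_prod le_imp_power_dvd) auto
  note interval = dvd_interval_mult_prime_power[OF q this, of "a (Suc r)" "x (Suc r)"]
  have inj_I: "inj_on (\<lambda>(d, j). d * ?q ^ j) (?I \<times> ?J)"
    by (rule inj_on_subset[OF inj_on_mult_prime_power[OF q]]) auto
  \<comment> \<open>The factor \<open>?q ^ j\<close> fixes the multiplicity of \<open>?q\<close> and
    does not affect that of the earlier primes, so the candidate value splits.\<close>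
  have G: "?G (Suc r) (d * ?q ^ j) = ?G r d \<otimes> h (j + 1)" if "d \<in> ?I" for d j
  proof -
    have "\<not> ?q dvd d"
      using that q(2) dvd_trans[of ?q d] by blast
    then have "d \<noteq> 0" and j: "multiplicity ?q (d * ?q ^ j) = j"
      using q(1) by (auto intro!: multiplicity_eqI intro: Nat.gr0I simp: prime_gt_0_nat)
    have "multiplicity (p i) (d * ?q ^ j) = multiplicity (p i) d" if i: "i \<in> {1..r}" for i
    proof -
      have "prime (p i)" "p i \<noteq> ?q"
        using i primes Suc.prems(1) inj_onD[OF inj, of i "Suc r"] by auto
      then have "multiplicity (p i) (?q ^ j) = 0"
        using q(1) by (intro not_dvd_imp_multiplicity_0) (metis prime_dvd_power primes_dvd_imp_eq)
      then show ?thesis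
        using \<open>prime (p i)\<close> \<open>d \<noteq> 0\<close> q(1) by (simp add: prime_elem_multiplicity_mult_distrib)
    qed
    then have "?G r (d * ?q ^ j) = ?G r d"
      by (intro nim_prod_cong) auto
    then show ?thesis
      using j by simp
  qed
  have "nim_Sum (?G (Suc r)) {t. ?A * ?q ^ a (Suc r) dvd t \<and> t dvd ?Y * ?q ^ x (Suc r)} =
      nim_Sum (?G (Suc r) \<circ> (\<lambda>(d, j). d * ?q ^ j)) (?I \<times> ?J)"
    unfolding interval by (rule nim_Sum.reindex[OF inj_I])
  also have "\<dots> = nim_Sum (\<lambda>(d, j). ?G r d \<otimes> h (j + 1)) (?I \<times> ?J)"
    using G by (intro nim_Sum.cong refl) (auto simp del: nim_prod.simps)
  also have "\<dots> = nim_Sum (?G r) ?I \<otimes> nim_Sum (\<lambda>j. h (j + 1)) ?J"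
    by (rule nim_Sum_product[symmetric])
  also have "nim_Sum (?G r) ?I = nim_prod (\<lambda>i. nim_Sum (\<lambda>j. h (j + 1)) {a i..x i}) r"
    using Suc by auto
  finally show ?case
    by simp
qed

end

text \<open>The maximum of an interval is its upper end, and divisors of \<open>m\<close> are
  automatically divisors of \<open>n\<close>. Thus the moves at \<open>m\<close> are indexed by
  lower ends, with no reference to \<open>n\<close>.\<close>

lemma closed_intervals_divisors_max:
  assumes "m \<in> divisors n"
  shows "{T \<in> closed_intervals (divisors n) (dvd). is_maximum (dvd) T m} =
    (\<lambda>a. {t. a dvd t \<and> t dvd m}) ` {a. a dvd m}"
proof (intro equalityI subsetI)
  fix T assume "T \<in> {T \<in> closed_intervals (divisors n) (dvd). is_maximum (dvd) T m}"
  then obtain a b where ab: "a \<in> divisors n" "b \<in> divisors n" "a dvd b"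
    and T: "T = {t \<in> divisors n. a dvd t \<and> t dvd b}" and "is_maximum (dvd) T m"
    by (auto simp: closed_intervals_def)
  then have "m \<in> T" "b dvd m"
    by (auto simp: is_maximum_def)
  then have "b = m"
    using T dvd_antisym by blast
  moreover have "t \<in> divisors n" if "t dvd m" for t
    using that assms by (auto simp: divisors_def intro: dvd_trans Nat.gr0I)
  ultimately show "T \<in> (\<lambda>a. {t. a dvd t \<and> t dvd m}) ` {a. a dvd m}"
    using T ab by blast
next
  fix T assume "T \<in> (\<lambda>a. {t. a dvd t \<and> t dvd m}) ` {a. a dvd m}"
  then obtain a where a: "a dvd m" "T = {t. a dvd t \<and> t dvd m}"
    by blast
  have D: "t \<in> divisors n" if "t dvd m" for t
    using that assms by (auto simp: divisors_def intro: dvd_trans Nat.gr0I)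
  then have "T = {t \<in> divisors n. a dvd t \<and> t dvd m}"
    using a by blast
  then have "T \<in> closed_intervals (divisors n) (dvd)"
    using D[of a] a(1) assms unfolding closed_intervals_def by blast
  then show "T \<in> {T \<in> closed_intervals (divisors n) (dvd). is_maximum (dvd) T m}"
    using a by (simp add: is_maximum_def)
qed

theorem mainTheorem2:
  fixes r n y :: nat and p e x :: "nat \<Rightarrow> nat"
  assumes "\<forall>i\<in>{1..r}. prime (p i)"
    and "inj_on p {1..r}"
    and "\<forall>i\<in>{1..r}. e i > 0"
    and "n = (\<Prod>i=1..r. p i ^ e i)"
    and "\<forall>i\<in>{1..r}. x i \<le> e i"
    and "y = (\<Prod>i=1..r. p i ^ x i)"
  shows "ruler_grundy (divisors n) (dvd) y = nim_prod (\<lambda>i. h (x i + 1)) r"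
proof -
  note P = assms(1,2)
  \<comment> \<open>Reading the exponents off as multiplicities makes the candidate a function of
    the coin itself, as \<open>grundy_eq_nim_Sum\<close> requires.\<close>
  define G where "G t = nim_prod (\<lambda>i. h (multiplicity (p i) t + 1)) r" for t
  have G_prod: "G (\<Prod>i=1..r. p i ^ z i) = nim_prod (\<lambda>i. h (z i + 1)) r" for z
    unfolding G_def
    by (intro nim_prod_cong) (simp only: multiplicity_prod_prime_powers_index[OF P])
  have "n > 0"
    using assms(1,4) by (auto intro!: prod_pos simp: prime_gt_0_nat)
  then interpret coin_turning_game "divisors n" "(dvd)" "closed_intervals (divisors n) (dvd)"
    by (rule divisors_ruler_game)
  have "is_mex ((\<lambda>T. nim_Sum G T \<oplus> G m) `
      {T \<in> closed_intervals (divisors n) (dvd). is_maximum (dvd) T m}) (G m)"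
    if m: "m \<in> divisors n" for m
  proof -
    have "m dvd (\<Prod>i=1..r. p i ^ e i)"
      using m assms(4) by (simp add: divisors_def)
    then obtain z where z: "m = (\<Prod>i=1..r. p i ^ z i)"
      by (rule dvd_prod_prime_powersE[OF P order_refl])
    let ?D = "{a. \<forall>i\<in>{1..r}. a i \<le> z i}"
    \<comment> \<open>The lower ends become the exponent vectors below \<open>z\<close>, the index
      set of \<open>is_mex_box_ruler\<close>.\<close>
    have "{a. a dvd m} = (\<lambda>a. \<Prod>i=1..r. p i ^ a i) ` ?D"
    proof (intro equalityI subsetI)
      fix d assume "d \<in> {a. a dvd m}"
      then show "d \<in> (\<lambda>a. \<Prod>i=1..r. p i ^ a i) ` ?D"
        using dvd_prod_prime_powersE[OF P order_refl, of d z] z by blast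
    next
      fix d assume "d \<in> (\<lambda>a. \<Prod>i=1..r. p i ^ a i) ` ?D"
      then show "d \<in> {a. a dvd m}"
        unfolding z by (auto intro!: prod_dvd_prod le_imp_power_dvd)
    qed
    then have "(\<lambda>T. nim_Sum G T \<oplus> G m) `
        {T \<in> closed_intervals (divisors n) (dvd). is_maximum (dvd) T m} =
      (\<lambda>a. nim_Sum G {t. (\<Prod>i=1..r. p i ^ a i) dvd t \<and> t dvd m} \<oplus> G m) ` ?D"
      unfolding closed_intervals_divisors_max[OF m] by (simp add: image_image)
    also have "\<dots> = (\<lambda>a. nim_prod (\<lambda>i. nim_Sum (\<lambda>j. h (j + 1)) {a i..z i}) r \<oplus>
        nim_prod (\<lambda>i. h (z i + 1)) r) ` ?D"
    proof (intro image_cong HOL.refl)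
      fix a assume "a \<in> ?D"
      then have "nim_Sum G {t. (\<Prod>i=1..r. p i ^ a i) dvd t \<and> t dvd m} =
          nim_prod (\<lambda>i. nim_Sum (\<lambda>j. h (j + 1)) {a i..z i}) r"
        unfolding z G_def[abs_def] by (intro nim_Sum_dvd_interval[OF P order_refl]) blast
      moreover have "G m = nim_prod (\<lambda>i. h (z i + 1)) r"
        unfolding z by (rule G_prod)
      ultimately show "nim_Sum G {t. (\<Prod>i=1..r. p i ^ a i) dvd t \<and> t dvd m} \<oplus> G m =
          nim_prod (\<lambda>i. nim_Sum (\<lambda>j. h (j + 1)) {a i..z i}) r \<oplus> nim_prod (\<lambda>i. h (z i + 1)) r"
        by (simp only:)
    qed
    finally show ?thesis
      using is_mex_box_ruler[of z r] G_prod[of z] by (simp only: z)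
  qed
  moreover have "y dvd n"
    unfolding assms(4,6) using assms(5) by (intro prod_dvd_prod le_imp_power_dvd) auto
  then have "{y} \<subseteq> divisors n"
    using \<open>n > 0\<close> by (auto simp: divisors_def intro: Nat.gr0I)
  ultimately have "ruler_grundy (divisors n) (dvd) y = nim_Sum G {y}"
    unfolding ruler_grundy_def coin_grundy_def by (rule grundy_eq_nim_Sum)
  then show ?thesis
    using G_prod[of x] assms(6) by simp
qed

end
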